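(* Let $\mathcal L$ and $\mathcal P$ be Leibniz algebras over a field $\mathbb{K}$ together with an action of $\mathcal P$ on $\mathcal L$ given by $\mu_1:\mathcal L\times\mathcal P\to\mathcal L$ and $\mu_2:\mathcal P\times\mathcal L\to\mathcal L$. Define six trilinear maps, for $l,l_1,l_2\in\mathcal L$ and $p,p_1,p_2\in\mathcal P$, by $$m_1(l,p_1,p_2)=\mu_1(l,[p_1,p_2]),\quad m_2(p_1,l,p_2)=\mu_2(p_1,\mu_1(l,p_2)),\quad m_3(p_1,p_2,l)=\mu_2(p_1,\mu_2(p_2,l)),$$ $$m'_1(p,l_1,l_2)=\mu_2(p,[l_1,l_2]),\quad m'_2(l_1,p,l_2)=[l_1,\mu_2(p,l_2)],\quad m'_3(l_1,l_2,p)=[l_1,\mu_1(l_2,p)].$$ 1) These maps define an action of the ternary Leibniz algebra $T(\mathcal P)$ on the ternary Leibniz algebra $T(\mathcal L)$. 2) If $(\mathcal L,\mathcal P,\varphi)$ is a crossed module of Leibniz algebras (for the given action), then $(T(\mathcal L),T(\mathcal P),\varphi)$, with the action of $T(\mathcal P)$ on $T(\mathcal L)$ given by the six maps $m_1,m_2,m_3,m'_1,m'_2,m'_3$, is a crossed module of ternary Leibniz algebras. 3) Moreover, if $(\mathcal L',\mathcal P',\varphi')$ is another crossed module of Leibniz algebras and $(\alpha,\beta)$ is a morphism of crossed modules of Leibniz algebras from $(\mathcal L,\mathcal P,\varphi)$ to $(\mathcal L',\mathcal P',\varphi')$, then $(\alpha,\beta)$ is a morphism of crossed modules of ternary Leibniz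 algebras from $(T(\mathcal L),T(\mathcal P),\varphi)$ to $(T(\mathcal L'),T(\mathcal P'),\varphi')$ (the latter with the action defined by the same formulas).
   Context: Leibniz algebras. A (right) Leibniz algebra over $\mathbb{K}$ is a vector space with a bilinear bracket satisfying $[[x,y],z]=[x,[y,z]]+[[x,z],y]$. An action of a Leibniz algebra $\mathcal P$ on a Leibniz algebra $\mathcal L$ is a pair of bilinear maps $\mu_1:\mathcal L\times\mathcal P\to\mathcal L$, $\mu_2:\mathcal P\times\mathcal L\to\mathcal L$ such that for all $l,l_1,l_2\in\mathcal L$, $p,p_1,p_2\in\mathcal P$: $\mu_1([l_1,l_2],p)=[l_1,\mu_1(l_2,p)]+[\mu_1(l_1,p),l_2]$; $[\mu_1(l_1,p),l_2]=[l_1,\mu_2(p,l_2)]+\mu_1([l_1,l_2],p)$; $[\mu_2(p,l_1),l_2]=\mu_2(p,[l_1,l_2])+[\mu_2(p,l_2),l_1]$; $\mu_2([p_1,p_2],l)=\mu_2(p_1,\mu_2(p_2,l))+\mu_1(\mu_2(p_1,l),p_2)$; $\mu_1(\mu_2(p_1,l),p_2)=\mu_2(p_1,\mu_1(l,p_2))+\mu_2([p_1,p_2],l)$; $\mu_1(\mu_1(l,p_1),p_2)=\mu_1(l,[p_1,p_2])+\mu_1(\mu_1(l,p_2),p_1)$. A crossed module of Leibniz algebras $(\mathcal L,\mathcal P,\varphi)$ is a Leibniz morphism $\varphi:\mathcal L\to\mathcal P$ with an action of $\mathcal P$ on $\mathcal L$ such that $\varphi\mu_1(l,p)=[\varphi(l),p]$,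 $\varphi\mu_2(p,l)=[p,\varphi(l)]$, $\mu_2(\varphi(l_1),l_2)=[l_1,l_2]=\mu_1(l_1,\varphi(l_2))$. A morphism $(\mathcal L,\mathcal P,\varphi)\to(\mathcal L',\mathcal P',\varphi')$ is a pair of Leibniz morphisms $\alpha:\mathcal L\to\mathcal L'$, $\beta:\mathcal P\to\mathcal P'$ with $\beta\varphi=\varphi'\alpha$, $\alpha\mu_1(l,p)=\mu_1'(\alpha(l),\beta(p))$, $\alpha\mu_2(p,l)=\mu'_2(\beta(p),\alpha(l))$. Ternary Leibniz algebras. A (right) ternary Leibniz algebra is a vector space with a trilinear bracket satisfying $[[x,y,z],t,u]=[x,y,[z,t,u]]+[x,[y,t,u],z]+[[x,t,u],y,z]$. Morphisms are linear maps preserving the bracket. For a Leibniz algebra $\mathcal L$, $T(\mathcal L)$ is the ternary Leibniz algebra on the vector space $\mathcal L$ with bracket $\{x,y,z\}=[x,[y,z]]$ (it is known that this is a ternary Leibniz algebra). An action of a ternary Leibniz algebra $\mathcal P$ on a ternary Leibniz algebra $\mathcal L$ consists of six trilinear maps $m_1:\mathcal L\times\mathcal P\times\mathcal P\to\mathcal L$, $m_2:\mathcal P\times\mathcal L\times\mathcal P\to\mathcal L$, $m_3:\mathcal P\times\mathcal P\times\mathcal L\to\mathcal L$, $m'_1:\mathcal P\times\mathcal L\times\mathcal L\to\mathcal L$, $m'_2:\mathcal L\times\mathcal P\times\mathcal L\to\mathcal L$, $m'_3:\mathcal L\times\mathcal L\times\mathcal P\to\mathcal L$ satisfying the 30 equalities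 obtained from the ternary Leibniz identity by letting each of its five variables lie in $\mathcal L$ or in $\mathcal P$, not all five in the same algebra, where a bracket of three elements is the bracket of $\mathcal L$ or $\mathcal P$ if all three lie in the same algebra and otherwise is the unique one of the six maps with matching domain. A crossed module of ternary Leibniz algebras $(\mathcal L,\mathcal P,\varphi)$ is a morphism $\varphi:\mathcal L\to\mathcal P$ with an action of $\mathcal P$ on $\mathcal L$ such that, for all $l,l_i\in\mathcal L$, $p,p_i\in\mathcal P$ (brackets denoting ternary brackets): (i) $\varphi m_1(l,p_1,p_2)=[\varphi(l),p_1,p_2]$, $\varphi m_2(p_1,l,p_2)=[p_1,\varphi(l),p_2]$, $\varphi m_3(p_1,p_2,l)=[p_1,p_2,\varphi(l)]$, $\varphi m'_1(p,l_1,l_2)=[p,\varphi(l_1),\varphi(l_2)]$, $\varphi m'_2(l_1,p,l_2)=[\varphi(l_1),p,\varphi(l_2)]$, $\varphi m'_3(l_1,l_2,p)=[\varphi(l_1),\varphi(l_2),p]$; (ii) $[l_1,l_2,l_3]=m'_1(\varphi(l_1),l_2,l_3)=m'_2(l_1,\varphi(l_2),l_3)=m'_3(l_1,l_2,\varphi(l_3))$ and $m_3(\varphi(l_1),\varphi(l_2),l_3)=m_2(\varphi(l_1),l_2,\varphi(l_3))=m_1(l_1,\varphi(l_2),\varphi(l_3))$; (iii) $m'_3(l_1,l_2,p)=m_2(\varphi(l_1),l_2,p)=m_1(l_1,\varphi(l_2),p)$, $m'_2(l_1,p,l_2)=m_3(\varphi(l_1),p,l_2)=m_1(l_1,p,\varphi(l_2))$,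 $m'_1(p,l_1,l_2)=m_3(p,\varphi(l_1),l_2)=m_2(p,l_1,\varphi(l_2))$. A morphism of crossed modules of ternary Leibniz algebras $(\mathcal L,\mathcal P,\varphi)\to(\mathcal L',\mathcal P',\varphi')$ is a pair of morphisms $\alpha:\mathcal L\to\mathcal L'$, $\beta:\mathcal P\to\mathcal P'$ of ternary Leibniz algebras with $\varphi'\alpha=\beta\varphi$ such that each of the six action maps is carried to the corresponding one by applying $\alpha$ to arguments in $\mathcal L$ and $\beta$ to arguments in $\mathcal P$ (e.g. $\alpha m_1(l,p_1,p_2)=n_1(\alpha(l),\beta(p_1),\beta(p_2))$, where $n_i,n_i'$ are the action maps of $\mathcal P'$ on $\mathcal L'$). *)

theory Defs
  imports Complex_Main
begin

text \<open>
  Vector spaces are given, as in \<^theory>\<open>HOL.Vector_Spaces\<close>, by a type of class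
  \<^class>\<open>ab_group_add\<close> together with a scalar multiplication over a type of class
  \<^class>\<open>field\<close>. The predicate \<^const>\<open>Vector_Spaces.linear\<close> includes the vector space
  axioms for both its source and its target.
\<close>

definition bilinear_map ::
  "('k::field \<Rightarrow> 'a::ab_group_add \<Rightarrow> 'a) \<Rightarrow> ('k \<Rightarrow> 'b::ab_group_add \<Rightarrow> 'b) \<Rightarrow>
   ('k \<Rightarrow> 'c::ab_group_add \<Rightarrow> 'c) \<Rightarrow> ('a \<Rightarrow> 'b \<Rightarrow> 'c) \<Rightarrow> bool" where
  "bilinear_map sA sB sC f \<longleftrightarrow>
     (\<forall>y. Vector_Spaces.linear sA sC (\<lambda>x. f x y)) \<and>
     (\<forall>x. Vector_Spaces.linear sB sC (\<lambda>y. f x y))"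

definition trilinear_map ::
  "('k::field \<Rightarrow> 'a::ab_group_add \<Rightarrow> 'a) \<Rightarrow> ('k \<Rightarrow> 'b::ab_group_add \<Rightarrow> 'b) \<Rightarrow>
   ('k \<Rightarrow> 'c::ab_group_add \<Rightarrow> 'c) \<Rightarrow> ('k \<Rightarrow> 'd::ab_group_add \<Rightarrow> 'd) \<Rightarrow>
   ('a \<Rightarrow> 'b \<Rightarrow> 'c \<Rightarrow> 'd) \<Rightarrow> bool" where
  "trilinear_map sA sB sC sD f \<longleftrightarrow>
     (\<forall>y z. Vector_Spaces.linear sA sD (\<lambda>x. f x y z)) \<and>
     (\<forall>x z. Vector_Spaces.linear sB sD (\<lambda>y. f x y z)) \<and>
     (\<forall>x y. Vector_Spaces.linear sC sD (\<lambda>z. f x y z))"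


section \<open>Leibniz algebras\<close>

locale leibniz_algebra = vector_space scale
  for scale :: "'k::field \<Rightarrow> 'a::ab_group_add \<Rightarrow> 'a" +
  fixes br :: "'a \<Rightarrow> 'a \<Rightarrow> 'a"
  assumes bilinear: "bilinear_map scale scale scale br"
    and leibniz: "\<And>x y z. br (br x y) z = br x (br y z) + br (br x z) y"

locale leibniz_hom = A: leibniz_algebra sA brA + B: leibniz_algebra sB brB
  for sA :: "'k::field \<Rightarrow> 'a::ab_group_add \<Rightarrow> 'a" and brA
    and sB :: "'k \<Rightarrow> 'b::ab_group_add \<Rightarrow> 'b" and brB +
  fixes f :: "'a \<Rightarrow> 'b"
  assumes linear: "Vector_Spaces.linear sA sB f"
    and hom: "\<And>x y. f (brA x y) = brB (f x) (f y)"

locale leibniz_action = L: leibniz_algebra sL brL + P: leibniz_algebra sP brP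
  for sL :: "'k::field \<Rightarrow> 'l::ab_group_add \<Rightarrow> 'l" and brL
    and sP :: "'k \<Rightarrow> 'p::ab_group_add \<Rightarrow> 'p" and brP +
  fixes \<mu>1 :: "'l \<Rightarrow> 'p \<Rightarrow> 'l" and \<mu>2 :: "'p \<Rightarrow> 'l \<Rightarrow> 'l"
  assumes bilinear1: "bilinear_map sL sP sL \<mu>1"
    and bilinear2: "bilinear_map sP sL sL \<mu>2"
    and action1: "\<And>l1 l2 p. \<mu>1 (brL l1 l2) p = brL l1 (\<mu>1 l2 p) + brL (\<mu>1 l1 p) l2"
    and action2: "\<And>l1 l2 p. brL (\<mu>1 l1 p) l2 = brL l1 (\<mu>2 p l2) + \<mu>1 (brL l1 l2) p"
    and action3: "\<And>l1 l2 p. brL (\<mu>2 p l1) l2 = \<mu>2 p (brL l1 l2) + brL (\<mu>2 p l2) l1"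
    and action4: "\<And>l p1 p2. \<mu>2 (brP p1 p2) l = \<mu>2 p1 (\<mu>2 p2 l) + \<mu>1 (\<mu>2 p1 l) p2"
    and action5: "\<And>l p1 p2. \<mu>1 (\<mu>2 p1 l) p2 = \<mu>2 p1 (\<mu>1 l p2) + \<mu>2 (brP p1 p2) l"
    and action6: "\<And>l p1 p2. \<mu>1 (\<mu>1 l p1) p2 = \<mu>1 l (brP p1 p2) + \<mu>1 (\<mu>1 l p2) p1"

locale leibniz_crossed_module =
  leibniz_action sL brL sP brP \<mu>1 \<mu>2 + leibniz_hom sL brL sP brP \<phi>
  for sL :: "'k::field \<Rightarrow> 'l::ab_group_add \<Rightarrow> 'l" and brL
    and sP :: "'k \<Rightarrow> 'p::ab_group_add \<Rightarrow> 'p" and brP and \<mu>1 \<mu>2 and \<phi> :: "'l \<Rightarrow> 'p" +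
  assumes equivariant1: "\<And>l p. \<phi> (\<mu>1 l p) = brP (\<phi> l) p"
    and equivariant2: "\<And>l p. \<phi> (\<mu>2 p l) = brP p (\<phi> l)"
    and peiffer1: "\<And>l1 l2. \<mu>2 (\<phi> l1) l2 = brL l1 l2"
    and peiffer2: "\<And>l1 l2. brL l1 l2 = \<mu>1 l1 (\<phi> l2)"

locale leibniz_crossed_module_hom =
  C: leibniz_crossed_module sL brL sP brP \<mu>1 \<mu>2 \<phi> +
  C': leibniz_crossed_module sL' brL' sP' brP' \<mu>1' \<mu>2' \<phi>' +
  \<alpha>: leibniz_hom sL brL sL' brL' \<alpha> +
  \<beta>: leibniz_hom sP brP sP' brP' \<beta>
  for sL :: "'k::field \<Rightarrow> 'l::ab_group_add \<Rightarrow> 'l" and brL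
    and sP :: "'k \<Rightarrow> 'p::ab_group_add \<Rightarrow> 'p" and brP and \<mu>1 \<mu>2 \<phi>
    and sL' :: "'k \<Rightarrow> 'm::ab_group_add \<Rightarrow> 'm" and brL'
    and sP' :: "'k \<Rightarrow> 'q::ab_group_add \<Rightarrow> 'q" and brP' and \<mu>1' \<mu>2' \<phi>'
    and \<alpha> :: "'l \<Rightarrow> 'm" and \<beta> :: "'p \<Rightarrow> 'q" +
  assumes commutes: "\<And>l. \<beta> (\<phi> l) = \<phi>' (\<alpha> l)"
    and hom_action1: "\<And>l p. \<alpha> (\<mu>1 l p) = \<mu>1' (\<alpha> l) (\<beta> p)"
    and hom_action2: "\<And>l p. \<alpha> (\<mu>2 p l) = \<mu>2' (\<beta> p) (\<alpha> l)"


section \<open>Ternary Leibniz algebras\<close>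

locale ternary_leibniz_algebra = vector_space scale
  for scale :: "'k::field \<Rightarrow> 'a::ab_group_add \<Rightarrow> 'a" +
  fixes br :: "'a \<Rightarrow> 'a \<Rightarrow> 'a \<Rightarrow> 'a"
  assumes trilinear: "trilinear_map scale scale scale scale br"
    and ternary_leibniz:
      "\<And>x y z t u. br (br x y z) t u = br x y (br z t u) + br x (br y t u) z + br (br x t u) y z"

locale ternary_leibniz_hom = A: ternary_leibniz_algebra sA brA + B: ternary_leibniz_algebra sB brB
  for sA :: "'k::field \<Rightarrow> 'a::ab_group_add \<Rightarrow> 'a" and brA
    and sB :: "'k \<Rightarrow> 'b::ab_group_add \<Rightarrow> 'b" and brB +
  fixes f :: "'a \<Rightarrow> 'b"
  assumes linear: "Vector_Spaces.linear sA sB f"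
    and hom: "\<And>x y z. f (brA x y z) = brB (f x) (f y) (f z)"

record ('l, 'p) ternary_maps =
  m1 :: "'l \<Rightarrow> 'p \<Rightarrow> 'p \<Rightarrow> 'l"
  m2 :: "'p \<Rightarrow> 'l \<Rightarrow> 'p \<Rightarrow> 'l"
  m3 :: "'p \<Rightarrow> 'p \<Rightarrow> 'l \<Rightarrow> 'l"
  m1' :: "'p \<Rightarrow> 'l \<Rightarrow> 'l \<Rightarrow> 'l"
  m2' :: "'l \<Rightarrow> 'p \<Rightarrow> 'l \<Rightarrow> 'l"
  m3' :: "'l \<Rightarrow> 'l \<Rightarrow> 'p \<Rightarrow> 'l"

text \<open>
  A variable that may lie in either algebra is an element of the sum type: \<^const>\<open>Inl\<close> for the
  algebra acted upon, \<^const>\<open>Inr\<close> for the acting one.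
\<close>

fun mixed_bracket ::
  "('l \<Rightarrow> 'l \<Rightarrow> 'l \<Rightarrow> 'l) \<Rightarrow> ('p \<Rightarrow> 'p \<Rightarrow> 'p \<Rightarrow> 'p) \<Rightarrow> ('l, 'p) ternary_maps \<Rightarrow>
   'l + 'p \<Rightarrow> 'l + 'p \<Rightarrow> 'l + 'p \<Rightarrow> 'l + 'p" where
  "mixed_bracket bL bP M (Inl x) (Inl y) (Inl z) = Inl (bL x y z)"
| "mixed_bracket bL bP M (Inr x) (Inr y) (Inr z) = Inr (bP x y z)"
| "mixed_bracket bL bP M (Inl x) (Inr y) (Inr z) = Inl (m1 M x y z)"
| "mixed_bracket bL bP M (Inr x) (Inl y) (Inr z) = Inl (m2 M x y z)"
| "mixed_bracket bL bP M (Inr x) (Inr y) (Inl z) = Inl (m3 M x y z)"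
| "mixed_bracket bL bP M (Inr x) (Inl y) (Inl z) = Inl (m1' M x y z)"
| "mixed_bracket bL bP M (Inl x) (Inr y) (Inl z) = Inl (m2' M x y z)"
| "mixed_bracket bL bP M (Inl x) (Inl y) (Inr z) = Inl (m3' M x y z)"

text \<open>
  The 30 equalities. As soon as one of the five variables lies in the algebra acted upon, so do
  all four iterated brackets, hence \<^const>\<open>projl\<close> is only applied to values of the form
  \<^term>\<open>Inl l\<close>; the lemma below lists the equalities one by one.
\<close>

definition ternary_action_identities ::
  "('l::ab_group_add \<Rightarrow> 'l \<Rightarrow> 'l \<Rightarrow> 'l) \<Rightarrow> ('p \<Rightarrow> 'p \<Rightarrow> 'p \<Rightarrow> 'p) \<Rightarrow> ('l, 'p) ternary_maps \<Rightarrow> bool"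
  where
  "ternary_action_identities bL bP M \<longleftrightarrow>
     (let b = mixed_bracket bL bP M in
      \<forall>x y z t u.
        (\<exists>v\<in>{x, y, z, t, u}. isl v) \<and> (\<exists>v\<in>{x, y, z, t, u}. \<not> isl v) \<longrightarrow>
        projl (b (b x y z) t u) =
          projl (b x y (b z t u)) + projl (b x (b y t u) z) + projl (b (b x t u) y z))"

lemma ternary_action_identities_iff:
  fixes bL :: "'l::ab_group_add \<Rightarrow> 'l \<Rightarrow> 'l \<Rightarrow> 'l" and bP :: "'p \<Rightarrow> 'p \<Rightarrow> 'p \<Rightarrow> 'p"
  shows
  "ternary_action_identities bL bP M \<longleftrightarrow>
     (\<forall>l1 l2 l3 l4 p5. m3' M (bL l1 l2 l3) l4 p5 =
       bL l1 l2 (m3' M l3 l4 p5) + bL l1 (m3' M l2 l4 p5) l3 + bL (m3' M l1 l4 p5) l2 l3) \<and>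
     (\<forall>l1 l2 l3 p4 l5. m2' M (bL l1 l2 l3) p4 l5 =
       bL l1 l2 (m2' M l3 p4 l5) + bL l1 (m2' M l2 p4 l5) l3 + bL (m2' M l1 p4 l5) l2 l3) \<and>
     (\<forall>l1 l2 l3 p4 p5. m1 M (bL l1 l2 l3) p4 p5 =
       bL l1 l2 (m1 M l3 p4 p5) + bL l1 (m1 M l2 p4 p5) l3 + bL (m1 M l1 p4 p5) l2 l3) \<and>
     (\<forall>l1 l2 p3 l4 l5. bL (m3' M l1 l2 p3) l4 l5 =
       bL l1 l2 (m1' M p3 l4 l5) + m3' M l1 (bL l2 l4 l5) p3 + m3' M (bL l1 l4 l5) l2 p3) \<and>
     (\<forall>l1 l2 p3 l4 p5. m3' M (m3' M l1 l2 p3) l4 p5 =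
       bL l1 l2 (m2 M p3 l4 p5) + m3' M l1 (m3' M l2 l4 p5) p3 + m3' M (m3' M l1 l4 p5) l2 p3) \<and>
     (\<forall>l1 l2 p3 p4 l5. m2' M (m3' M l1 l2 p3) p4 l5 =
       bL l1 l2 (m3 M p3 p4 l5) + m3' M l1 (m2' M l2 p4 l5) p3 + m3' M (m2' M l1 p4 l5) l2 p3) \<and>
     (\<forall>l1 l2 p3 p4 p5. m1 M (m3' M l1 l2 p3) p4 p5 =
       m3' M l1 l2 (bP p3 p4 p5) + m3' M l1 (m1 M l2 p4 p5) p3 + m3' M (m1 M l1 p4 p5) l2 p3) \<and>
     (\<forall>l1 p2 l3 l4 l5. bL (m2' M l1 p2 l3) l4 l5 =
       m2' M l1 p2 (bL l3 l4 l5) + bL l1 (m1' M p2 l4 l5) l3 + m2' M (bL l1 l4 l5) p2 l3) \<and>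
     (\<forall>l1 p2 l3 l4 p5. m3' M (m2' M l1 p2 l3) l4 p5 =
       m2' M l1 p2 (m3' M l3 l4 p5) + bL l1 (m2 M p2 l4 p5) l3 + m2' M (m3' M l1 l4 p5) p2 l3) \<and>
     (\<forall>l1 p2 l3 p4 l5. m2' M (m2' M l1 p2 l3) p4 l5 =
       m2' M l1 p2 (m2' M l3 p4 l5) + bL l1 (m3 M p2 p4 l5) l3 + m2' M (m2' M l1 p4 l5) p2 l3) \<and>
     (\<forall>l1 p2 l3 p4 p5. m1 M (m2' M l1 p2 l3) p4 p5 =
       m2' M l1 p2 (m1 M l3 p4 p5) + m2' M l1 (bP p2 p4 p5) l3 + m2' M (m1 M l1 p4 p5) p2 l3) \<and>
     (\<forall>l1 p2 p3 l4 l5. bL (m1 M l1 p2 p3) l4 l5 =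
       m2' M l1 p2 (m1' M p3 l4 l5) + m3' M l1 (m1' M p2 l4 l5) p3 + m1 M (bL l1 l4 l5) p2 p3) \<and>
     (\<forall>l1 p2 p3 l4 p5. m3' M (m1 M l1 p2 p3) l4 p5 =
       m2' M l1 p2 (m2 M p3 l4 p5) + m3' M l1 (m2 M p2 l4 p5) p3 + m1 M (m3' M l1 l4 p5) p2 p3) \<and>
     (\<forall>l1 p2 p3 p4 l5. m2' M (m1 M l1 p2 p3) p4 l5 =
       m2' M l1 p2 (m3 M p3 p4 l5) + m3' M l1 (m3 M p2 p4 l5) p3 + m1 M (m2' M l1 p4 l5) p2 p3) \<and>
     (\<forall>l1 p2 p3 p4 p5. m1 M (m1 M l1 p2 p3) p4 p5 =
       m1 M l1 p2 (bP p3 p4 p5) + m1 M l1 (bP p2 p4 p5) p3 + m1 M (m1 M l1 p4 p5) p2 p3) \<and>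
     (\<forall>p1 l2 l3 l4 l5. bL (m1' M p1 l2 l3) l4 l5 =
       m1' M p1 l2 (bL l3 l4 l5) + m1' M p1 (bL l2 l4 l5) l3 + bL (m1' M p1 l4 l5) l2 l3) \<and>
     (\<forall>p1 l2 l3 l4 p5. m3' M (m1' M p1 l2 l3) l4 p5 =
       m1' M p1 l2 (m3' M l3 l4 p5) + m1' M p1 (m3' M l2 l4 p5) l3 + bL (m2 M p1 l4 p5) l2 l3) \<and>
     (\<forall>p1 l2 l3 p4 l5. m2' M (m1' M p1 l2 l3) p4 l5 =
       m1' M p1 l2 (m2' M l3 p4 l5) + m1' M p1 (m2' M l2 p4 l5) l3 + bL (m3 M p1 p4 l5) l2 l3) \<and>
     (\<forall>p1 l2 l3 p4 p5. m1 M (m1' M p1 l2 l3) p4 p5 =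
       m1' M p1 l2 (m1 M l3 p4 p5) + m1' M p1 (m1 M l2 p4 p5) l3 + m1' M (bP p1 p4 p5) l2 l3) \<and>
     (\<forall>p1 l2 p3 l4 l5. bL (m2 M p1 l2 p3) l4 l5 =
       m1' M p1 l2 (m1' M p3 l4 l5) + m2 M p1 (bL l2 l4 l5) p3 + m3' M (m1' M p1 l4 l5) l2 p3) \<and>
     (\<forall>p1 l2 p3 l4 p5. m3' M (m2 M p1 l2 p3) l4 p5 =
       m1' M p1 l2 (m2 M p3 l4 p5) + m2 M p1 (m3' M l2 l4 p5) p3 + m3' M (m2 M p1 l4 p5) l2 p3) \<and>
     (\<forall>p1 l2 p3 p4 l5. m2' M (m2 M p1 l2 p3) p4 l5 =
       m1' M p1 l2 (m3 M p3 p4 l5) + m2 M p1 (m2' M l2 p4 l5) p3 + m3' M (m3 M p1 p4 l5) l2 p3) \<and>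
     (\<forall>p1 l2 p3 p4 p5. m1 M (m2 M p1 l2 p3) p4 p5 =
       m2 M p1 l2 (bP p3 p4 p5) + m2 M p1 (m1 M l2 p4 p5) p3 + m2 M (bP p1 p4 p5) l2 p3) \<and>
     (\<forall>p1 p2 l3 l4 l5. bL (m3 M p1 p2 l3) l4 l5 =
       m3 M p1 p2 (bL l3 l4 l5) + m1' M p1 (m1' M p2 l4 l5) l3 + m2' M (m1' M p1 l4 l5) p2 l3) \<and>
     (\<forall>p1 p2 l3 l4 p5. m3' M (m3 M p1 p2 l3) l4 p5 =
       m3 M p1 p2 (m3' M l3 l4 p5) + m1' M p1 (m2 M p2 l4 p5) l3 + m2' M (m2 M p1 l4 p5) p2 l3) \<and>
     (\<forall>p1 p2 l3 p4 l5. m2' M (m3 M p1 p2 l3) p4 l5 =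
       m3 M p1 p2 (m2' M l3 p4 l5) + m1' M p1 (m3 M p2 p4 l5) l3 + m2' M (m3 M p1 p4 l5) p2 l3) \<and>
     (\<forall>p1 p2 l3 p4 p5. m1 M (m3 M p1 p2 l3) p4 p5 =
       m3 M p1 p2 (m1 M l3 p4 p5) + m3 M p1 (bP p2 p4 p5) l3 + m3 M (bP p1 p4 p5) p2 l3) \<and>
     (\<forall>p1 p2 p3 l4 l5. m1' M (bP p1 p2 p3) l4 l5 =
       m3 M p1 p2 (m1' M p3 l4 l5) + m2 M p1 (m1' M p2 l4 l5) p3 + m1 M (m1' M p1 l4 l5) p2 p3) \<and>
     (\<forall>p1 p2 p3 l4 p5. m2 M (bP p1 p2 p3) l4 p5 =
       m3 M p1 p2 (m2 M p3 l4 p5) + m2 M p1 (m2 M p2 l4 p5) p3 + m1 M (m2 M p1 l4 p5) p2 p3) \<and>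
     (\<forall>p1 p2 p3 p4 l5. m3 M (bP p1 p2 p3) p4 l5 =
       m3 M p1 p2 (m3 M p3 p4 l5) + m2 M p1 (m3 M p2 p4 l5) p3 + m1 M (m3 M p1 p4 l5) p2 p3)"
proof -
  have all_sum: "(\<forall>x. Q x) \<longleftrightarrow> (\<forall>l. Q (Inl l)) \<and> (\<forall>p. Q (Inr p))" for Q :: "'l + 'p \<Rightarrow> bool"
    by (metis sum.exhaust)
  show ?thesis
    by (simp add: ternary_action_identities_def all_sum Let_def all_conj_distrib conj_ac)
qed

locale ternary_leibniz_action =
  L: ternary_leibniz_algebra sL brL + P: ternary_leibniz_algebra sP brP
  for sL :: "'k::field \<Rightarrow> 'l::ab_group_add \<Rightarrow> 'l" and brL
    and sP :: "'k \<Rightarrow> 'p::ab_group_add \<Rightarrow> 'p" and brP +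
  fixes M :: "('l, 'p) ternary_maps"
  assumes trilinear1: "trilinear_map sL sP sP sL (m1 M)"
    and trilinear2: "trilinear_map sP sL sP sL (m2 M)"
    and trilinear3: "trilinear_map sP sP sL sL (m3 M)"
    and trilinear1': "trilinear_map sP sL sL sL (m1' M)"
    and trilinear2': "trilinear_map sL sP sL sL (m2' M)"
    and trilinear3': "trilinear_map sL sL sP sL (m3' M)"
    and identities: "ternary_action_identities brL brP M"

locale ternary_leibniz_crossed_module =
  ternary_leibniz_action sL brL sP brP M + ternary_leibniz_hom sL brL sP brP \<phi>
  for sL :: "'k::field \<Rightarrow> 'l::ab_group_add \<Rightarrow> 'l" and brL
    and sP :: "'k \<Rightarrow> 'p::ab_group_add \<Rightarrow> 'p" and brP and M and \<phi> :: "'l \<Rightarrow> 'p" +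
  assumes equivariant1: "\<And>l p1 p2. \<phi> (m1 M l p1 p2) = brP (\<phi> l) p1 p2"
    and equivariant2: "\<And>l p1 p2. \<phi> (m2 M p1 l p2) = brP p1 (\<phi> l) p2"
    and equivariant3: "\<And>l p1 p2. \<phi> (m3 M p1 p2 l) = brP p1 p2 (\<phi> l)"
    and equivariant1': "\<And>l1 l2 p. \<phi> (m1' M p l1 l2) = brP p (\<phi> l1) (\<phi> l2)"
    and equivariant2': "\<And>l1 l2 p. \<phi> (m2' M l1 p l2) = brP (\<phi> l1) p (\<phi> l2)"
    and equivariant3': "\<And>l1 l2 p. \<phi> (m3' M l1 l2 p) = brP (\<phi> l1) (\<phi> l2) p"
    and peiffer1': "\<And>l1 l2 l3. brL l1 l2 l3 = m1' M (\<phi> l1) l2 l3"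
    and peiffer2': "\<And>l1 l2 l3. m1' M (\<phi> l1) l2 l3 = m2' M l1 (\<phi> l2) l3"
    and peiffer3': "\<And>l1 l2 l3. m2' M l1 (\<phi> l2) l3 = m3' M l1 l2 (\<phi> l3)"
    and peiffer32: "\<And>l1 l2 l3. m3 M (\<phi> l1) (\<phi> l2) l3 = m2 M (\<phi> l1) l2 (\<phi> l3)"
    and peiffer21: "\<And>l1 l2 l3. m2 M (\<phi> l1) l2 (\<phi> l3) = m1 M l1 (\<phi> l2) (\<phi> l3)"
    and mixed3'2: "\<And>l1 l2 p. m3' M l1 l2 p = m2 M (\<phi> l1) l2 p"
    and mixed21: "\<And>l1 l2 p. m2 M (\<phi> l1) l2 p = m1 M l1 (\<phi> l2) p"
    and mixed2'3: "\<And>l1 l2 p. m2' M l1 p l2 = m3 M (\<phi> l1) p l2"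
    and mixed31: "\<And>l1 l2 p. m3 M (\<phi> l1) p l2 = m1 M l1 p (\<phi> l2)"
    and mixed1'3: "\<And>l1 l2 p. m1' M p l1 l2 = m3 M p (\<phi> l1) l2"
    and mixed32: "\<And>l1 l2 p. m3 M p (\<phi> l1) l2 = m2 M p l1 (\<phi> l2)"

locale ternary_leibniz_crossed_module_hom =
  C: ternary_leibniz_crossed_module sL brL sP brP M \<phi> +
  C': ternary_leibniz_crossed_module sL' brL' sP' brP' N \<phi>' +
  \<alpha>: ternary_leibniz_hom sL brL sL' brL' \<alpha> +
  \<beta>: ternary_leibniz_hom sP brP sP' brP' \<beta>
  for sL :: "'k::field \<Rightarrow> 'l::ab_group_add \<Rightarrow> 'l" and brL
    and sP :: "'k \<Rightarrow> 'p::ab_group_add \<Rightarrow> 'p" and brP and M \<phi>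
    and sL' :: "'k \<Rightarrow> 'm::ab_group_add \<Rightarrow> 'm" and brL'
    and sP' :: "'k \<Rightarrow> 'q::ab_group_add \<Rightarrow> 'q" and brP' and N \<phi>'
    and \<alpha> :: "'l \<Rightarrow> 'm" and \<beta> :: "'p \<Rightarrow> 'q" +
  assumes commutes: "\<And>l. \<phi>' (\<alpha> l) = \<beta> (\<phi> l)"
    and hom1: "\<And>l p1 p2. \<alpha> (m1 M l p1 p2) = m1 N (\<alpha> l) (\<beta> p1) (\<beta> p2)"
    and hom2: "\<And>l p1 p2. \<alpha> (m2 M p1 l p2) = m2 N (\<beta> p1) (\<alpha> l) (\<beta> p2)"
    and hom3: "\<And>l p1 p2. \<alpha> (m3 M p1 p2 l) = m3 N (\<beta> p1) (\<beta> p2) (\<alpha> l)"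
    and hom1': "\<And>l1 l2 p. \<alpha> (m1' M p l1 l2) = m1' N (\<beta> p) (\<alpha> l1) (\<alpha> l2)"
    and hom2': "\<And>l1 l2 p. \<alpha> (m2' M l1 p l2) = m2' N (\<alpha> l1) (\<beta> p) (\<alpha> l2)"
    and hom3': "\<And>l1 l2 p. \<alpha> (m3' M l1 l2 p) = m3' N (\<alpha> l1) (\<alpha> l2) (\<beta> p)"


section \<open>From Leibniz algebras to ternary Leibniz algebras\<close>

definition T_bracket :: "('a \<Rightarrow> 'a \<Rightarrow> 'a) \<Rightarrow> 'a \<Rightarrow> 'a \<Rightarrow> 'a \<Rightarrow> 'a" where
  "T_bracket br x y z = br x (br y z)"

definition T_maps ::
  "('l \<Rightarrow> 'l \<Rightarrow> 'l) \<Rightarrow> ('p \<Rightarrow> 'p \<Rightarrow> 'p) \<Rightarrow> ('l \<Rightarrow> 'p \<Rightarrow> 'l) \<Rightarrow> ('p \<Rightarrow> 'l \<Rightarrow> 'l) \<Rightarrow>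
   ('l, 'p) ternary_maps" where
  "T_maps brL brP \<mu>1 \<mu>2 =
     \<lparr> m1 = \<lambda>l p1 p2. \<mu>1 l (brP p1 p2),
       m2 = \<lambda>p1 l p2. \<mu>2 p1 (\<mu>1 l p2),
       m3 = \<lambda>p1 p2 l. \<mu>2 p1 (\<mu>2 p2 l),
       m1' = \<lambda>p l1 l2. \<mu>2 p (brL l1 l2),
       m2' = \<lambda>l1 p l2. brL l1 (\<mu>2 p l2),
       m3' = \<lambda>l1 l2 p. brL l1 (\<mu>1 l2 p) \<rparr>"

end

theory Submission
  imports Defs
begin

text \<open>
  The Leibniz identity, and likewise each action identity, can be read as
  \<open>[x, [y, z]] = [[x, y], z] - [[x, z], y]\<close>. Applied from left to right, these equations rewrite
  every iterated bracket into a combination of left-normed ones; on left-normed brackets all the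
  ternary identities hold by cancellation.
\<close>

lemma linear_comp:
  assumes "Vector_Spaces.linear sA sB f" "Vector_Spaces.linear sB sC g"
  shows "Vector_Spaces.linear sA sC (\<lambda>x. g (f x))"
  using Vector_Spaces.linear_compose[OF assms] by (simp add: comp_def)

lemma bilinear_map_linear:
  assumes "bilinear_map sA sB sC f"
  shows "Vector_Spaces.linear sA sC (\<lambda>x. f x y)" "Vector_Spaces.linear sB sC (f x)"
  using assms by (simp_all add: bilinear_map_def)

text \<open>Rewriting to left-normed form creates differences inside other brackets; these rules
  pull them out.\<close>

lemma bilinear_map_diff:
  assumes "bilinear_map sA sB sC f"
  shows "f (x - x') y = f x y - f x' y" "f x (y - y') = f x y - f x y'"
  \<comment> \<open>The third part of \<open>Vector_Spaces.linear\<close> is its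
    \<open>module_hom\<close> component.\<close>
  using bilinear_map_linear[OF assms, THEN Vector_Spaces.linear.axioms(3), THEN module_hom.diff]
  by simp_all

text \<open>The bracket of T and all six maps of \<open>T_maps\<close> have the shape
  \<open>f x (g y z)\<close>, so this settles every trilinearity claim.\<close>

lemma trilinear_map_nest:
  assumes f: "bilinear_map sA sE sD f" and g: "bilinear_map sB sC sE g"
  shows "trilinear_map sA sB sC sD (\<lambda>x y z. f x (g y z))"
  unfolding trilinear_map_def
  by (auto intro!: bilinear_map_linear[OF f] linear_comp[OF _ bilinear_map_linear(2)[OF f]]
      bilinear_map_linear[OF g])

lemma bilinear_map_add:
  assumes "bilinear_map sA sB sC f"
  shows "f (x + x') y = f x y + f x' y" "f x (y + y') = f x y + f x y'"
  using bilinear_map_linear[OF assms, THEN Vector_Spaces.linear.axioms(3), THEN module_hom.add]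
  by simp_all

context leibniz_algebra
begin

lemma br_br_right: "br x (br y z) = br (br x y) z - br (br x z) y"
  using leibniz[of x y z] by (simp add: algebra_simps)

text \<open>Conceptually, right multiplication by \<open>br t u\<close> is a derivation of
  \<open>br\<close>, hence also of the nested bracket, which is the ternary identity. The proof
  verifies it by expansion.\<close>

lemma ternary_leibniz_algebra_T: "ternary_leibniz_algebra scale (T_bracket br)"
proof unfold_locales
  show "trilinear_map scale scale scale scale (T_bracket br)"
    using trilinear_map_nest[OF bilinear bilinear] by (simp add: T_bracket_def [abs_def])
qed (simp add: T_bracket_def br_br_right bilinear_map_diff[OF bilinear]
    bilinear_map_add[OF bilinear])

end

lemma (in leibniz_hom) ternary_leibniz_hom_T:
  "ternary_leibniz_hom sA (T_bracket brA) sB (T_bracket brB) f"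
  by (intro ternary_leibniz_hom.intro ternary_leibniz_hom_axioms.intro
      A.ternary_leibniz_algebra_T B.ternary_leibniz_algebra_T linear)
    (simp add: T_bracket_def hom)

context leibniz_action
begin

text \<open>An action is the Leibniz identity on the direct sum of L and P, split by the types of
  the three variables. These six mixed cases, together with \<open>br_br_right\<close> for L and for
  P, cover all eight patterns of a right-nested product.\<close>

lemma action_right:
  "brL l1 (\<mu>1 l2 p) = \<mu>1 (brL l1 l2) p - brL (\<mu>1 l1 p) l2"
  "brL l1 (\<mu>2 p l2) = brL (\<mu>1 l1 p) l2 - \<mu>1 (brL l1 l2) p"
  "\<mu>2 p (brL l1 l2) = brL (\<mu>2 p l1) l2 - brL (\<mu>2 p l2) l1"
  "\<mu>2 p1 (\<mu>2 p2 l) = \<mu>2 (brP p1 p2) l - \<mu>1 (\<mu>2 p1 l) p2"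
  "\<mu>2 p1 (\<mu>1 l p2) = \<mu>1 (\<mu>2 p1 l) p2 - \<mu>2 (brP p1 p2) l"
  "\<mu>1 l (brP p1 p2) = \<mu>1 (\<mu>1 l p1) p2 - \<mu>1 (\<mu>1 l p2) p1"
  by (metis add_diff_cancel_right' action1 action2 action3 action4 action5 action6)+

text \<open>Each map of \<open>T_maps\<close> is the mixed form of \<open>x(yz)\<close>, so the 30
  equalities are typed instances of the ternary identity and the same normalization proves
  them.\<close>

lemma ternary_leibniz_action_T:
  "ternary_leibniz_action sL (T_bracket brL) sP (T_bracket brP) (T_maps brL brP \<mu>1 \<mu>2)"
proof (intro ternary_leibniz_action.intro ternary_leibniz_action_axioms.intro
    L.ternary_leibniz_algebra_T P.ternary_leibniz_algebra_T)
  show "ternary_action_identities (T_bracket brL) (T_bracket brP) (T_maps brL brP \<mu>1 \<mu>2)"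
    unfolding ternary_action_identities_iff
    by (simp add: T_maps_def T_bracket_def action_right L.br_br_right P.br_br_right
        bilinear_map_diff[OF L.bilinear] bilinear_map_diff[OF P.bilinear]
        bilinear_map_diff[OF bilinear1] bilinear_map_diff[OF bilinear2]
        bilinear_map_add[OF L.bilinear] bilinear_map_add[OF P.bilinear]
        bilinear_map_add[OF bilinear1] bilinear_map_add[OF bilinear2])
qed (auto simp: T_maps_def intro: trilinear_map_nest L.bilinear P.bilinear bilinear1 bilinear2)

end

context leibniz_crossed_module
begin

text \<open>By equivariance the bracket in P is \<phi> of an element of L, and the Peiffer identity
  then turns \<open>\<mu>1\<close> into \<open>brL\<close>. This handles the conditions involving
  \<open>m1\<close>.\<close>

lemma \<mu>1_brP_\<phi>:
  "\<mu>1 l1 (brP (\<phi> l2) p) = brL l1 (\<mu>1 l2 p)"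
  "\<mu>1 l1 (brP p (\<phi> l2)) = brL l1 (\<mu>2 p l2)"
  by (simp_all add: peiffer2 equivariant1 equivariant2)

lemma ternary_leibniz_crossed_module_T:
  "ternary_leibniz_crossed_module sL (T_bracket brL) sP (T_bracket brP)
    (T_maps brL brP \<mu>1 \<mu>2) \<phi>"
  by (intro ternary_leibniz_crossed_module.intro ternary_leibniz_crossed_module_axioms.intro
      ternary_leibniz_action_T ternary_leibniz_hom_T)
    \<comment> \<open>Here \<open>peiffer2\<close> is reversed: in the Peiffer-type conditions,
      actions by \<phi>-images become brackets of L, and both sides coincide.\<close>
    (simp_all add: T_maps_def T_bracket_def hom equivariant1 equivariant2 peiffer1
      peiffer2[symmetric] \<mu>1_brP_\<phi>)

end

lemma (in leibniz_crossed_module_hom) ternary_leibniz_crossed_module_hom_T: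
  "ternary_leibniz_crossed_module_hom
    sL (T_bracket brL) sP (T_bracket brP) (T_maps brL brP \<mu>1 \<mu>2) \<phi>
    sL' (T_bracket brL') sP' (T_bracket brP') (T_maps brL' brP' \<mu>1' \<mu>2') \<phi>' \<alpha> \<beta>"
  by (intro ternary_leibniz_crossed_module_hom.intro
      ternary_leibniz_crossed_module_hom_axioms.intro
      C.ternary_leibniz_crossed_module_T C'.ternary_leibniz_crossed_module_T
      \<alpha>.ternary_leibniz_hom_T \<beta>.ternary_leibniz_hom_T)
    (simp_all add: T_maps_def commutes hom_action1 hom_action2 \<alpha>.hom \<beta>.hom)

theorem theorem3p3:
  fixes sL :: "'k::field \<Rightarrow> 'l::ab_group_add \<Rightarrow> 'l" and brL :: "'l \<Rightarrow> 'l \<Rightarrow> 'l"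
    and sP :: "'k \<Rightarrow> 'p::ab_group_add \<Rightarrow> 'p" and brP :: "'p \<Rightarrow> 'p \<Rightarrow> 'p"
    and \<mu>1 :: "'l \<Rightarrow> 'p \<Rightarrow> 'l" and \<mu>2 :: "'p \<Rightarrow> 'l \<Rightarrow> 'l"
  assumes "leibniz_action sL brL sP brP \<mu>1 \<mu>2"
  shows "ternary_leibniz_action sL (T_bracket brL) sP (T_bracket brP) (T_maps brL brP \<mu>1 \<mu>2) \<and>
    (\<forall>\<phi>. leibniz_crossed_module sL brL sP brP \<mu>1 \<mu>2 \<phi> \<longrightarrow>
      ternary_leibniz_crossed_module sL (T_bracket brL) sP (T_bracket brP)
        (T_maps brL brP \<mu>1 \<mu>2) \<phi> \<and>
      (\<forall>(sL' :: 'k \<Rightarrow> 'm::ab_group_add \<Rightarrow> 'm) brL' (sP' :: 'k \<Rightarrow> 'q::ab_group_add \<Rightarrow> 'q) brP'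
          \<mu>1' \<mu>2' \<phi>' \<alpha> \<beta>.
        leibniz_crossed_module sL' brL' sP' brP' \<mu>1' \<mu>2' \<phi>' \<longrightarrow>
        leibniz_crossed_module_hom sL brL sP brP \<mu>1 \<mu>2 \<phi> sL' brL' sP' brP' \<mu>1' \<mu>2' \<phi>' \<alpha> \<beta> \<longrightarrow>
        ternary_leibniz_crossed_module_hom
          sL (T_bracket brL) sP (T_bracket brP) (T_maps brL brP \<mu>1 \<mu>2) \<phi>
          sL' (T_bracket brL') sP' (T_bracket brP') (T_maps brL' brP' \<mu>1' \<mu>2') \<phi>' \<alpha> \<beta>))"
  by (intro conjI allI impI assms leibniz_action.ternary_leibniz_action_T
      leibniz_crossed_module.ternary_leibniz_crossed_module_T
      leibniz_crossed_module_hom.ternary_leibniz_crossed_module_hom_T)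

end
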